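(* Let $T\ge 2$ and $n\ge 2$ be integers, let $0\le m_i\le n$ be integers for $1\le i\le T$, and let $0\le t\le T$. Then, with all sums running over ordered pairs $(S,R)$ of $t$-element subsets, or over $t$-element subsets $S$, of $\{1,\dots,T\}$, $$E(x_t^2)=\sum_{|S|=|R|=t}E(x_S\,x_R)$$ $$=\sum_{\substack{|S|=|R|=t\\ S\ne R}}\frac{\prod_{i\in D(S,R)}m_i(n-m_i)\ \prod_{i\notin D(S,R)}m_i^S(m_i^S-1)}{n^{T-1}(n-1)^{T-1}}\;+\;\sum_{|S|=t}\frac{\prod_{i=1}^T m_i^S}{n^{T-1}}\left(1+\frac{\prod_{i=1}^T(m_i^S-1)}{(n-1)^{T-1}}\right).$$
   Context: General hypergeometric distribution: let $N$ be a finite set with $n$ elements. Choose subsets $M_1,\dots,M_T$ of $N$ independently, $M_i$ being uniformly distributed among all $\binom{n}{m_i}$ subsets of $N$ of size $m_i$. The random variable $x_t$ is the number of elements of $N$ that belong to exactly $t$ of the sets $M_1,\dots,M_T$. For $S\subseteq\{1,\dots,T\}$, $x_S$ is the number of elements of $N$ that belong to $M_i$ for every $i\in S$ and to no $M_i$ with $i\notin S$; and $m_i^S=m_i$ if $i\in S$, $m_i^S=n-m_i$ if $i\notin S$. For $S,R\subseteq\{1,\dots,T\}$, $D(S,R)=(S\setminus R)\cup(R\setminus S)$ is the symmetric difference; note that $m_i^S=m_i^R$ for $i\notin D(S,R)$. Empty products equal $1$. *)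

theory Defs
  imports "HOL-Probability.Probability"
begin

text \<open>
  Joint law of the independent uniform random subsets M(1), ..., M(T) of N with
  prescribed sizes m(1), ..., m(T). The argument \<open>{}\<close> of \<open>Pi_pmf\<close> is only the
  value M(i) gets at indices i outside {1..T}, which is never used.
\<close>
definition subsets_pmf :: "'a set \<Rightarrow> nat \<Rightarrow> (nat \<Rightarrow> nat) \<Rightarrow> (nat \<Rightarrow> 'a set) pmf" where
  "subsets_pmf N T m =
     Pi_pmf {1..T} {} (\<lambda>i. pmf_of_set {A. A \<subseteq> N \<and> card A = m i})"

definition x_num :: "'a set \<Rightarrow> nat \<Rightarrow> nat \<Rightarrow> (nat \<Rightarrow> 'a set) \<Rightarrow> nat" where
  "x_num N T t M = card {a \<in> N. card {i \<in> {1..T}. a \<in> M i} = t}"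

definition x_set :: "'a set \<Rightarrow> nat \<Rightarrow> nat set \<Rightarrow> (nat \<Rightarrow> 'a set) \<Rightarrow> nat" where
  "x_set N T S M = card {a \<in> N. (\<forall>i\<in>S. a \<in> M i) \<and> (\<forall>i\<in>{1..T} - S. a \<notin> M i)}"

text \<open>Real-valued, so that subtracting 1 does not truncate when the size is 0.\<close>
definition m_sup :: "nat \<Rightarrow> (nat \<Rightarrow> nat) \<Rightarrow> nat set \<Rightarrow> nat \<Rightarrow> real" where
  "m_sup n m S i = (if i \<in> S then real (m i) else real n - real (m i))"

definition tsubsets :: "nat \<Rightarrow> nat \<Rightarrow> nat set set" where
  "tsubsets T t = {S. S \<subseteq> {1..T} \<and> card S = t}"

end

theory Submission
  imports Defs
begin

text \<open>
  Give every element \<open>a\<close> of \<open>N\<close> its membership pattern, the set of all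
  indices \<open>i\<close> with \<open>a \<in> M i\<close>. Then \<open>x_set\<close> counts the elements with one given
  pattern, and \<open>x_num\<close> counts those whose pattern has size \<open>t\<close>; so \<open>x_num\<close> is the
  sum of the \<open>x_set\<close> over all patterns of size \<open>t\<close> (\<open>real_x_num\<close>). Squaring and
  linearity of expectation give the first equation.

  For the second one, write \<open>x_set\<close> for \<open>S\<close> times \<open>x_set\<close> for \<open>R\<close> as the number
  of pairs \<open>(a, b)\<close> in which \<open>a\<close> has pattern \<open>S\<close> and \<open>b\<close> has pattern \<open>R\<close>, and
  take expectations pair by pair. The event that a pair has two given patterns is an
  intersection over \<open>i\<close> of events on \<open>M i\<close> alone, so by independence its probability
  is a product over \<open>i\<close>. Each factor is the probability that one uniform subset of
  size \<open>k\<close> contains, or avoids, prescribed points of \<open>N\<close>; these follow from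
  \<open>expectation_superset\<close>, the probability of containing a given set, by inclusion and
  exclusion. For \<open>a \<noteq> b\<close> the factor has denominator \<open>n (n - 1)\<close>, and its numerator
  is \<open>m i (n - m i)\<close> if \<open>i\<close> lies in exactly one of \<open>S\<close> and \<open>R\<close>, and the product of
  \<open>m_sup\<close> and \<open>m_sup - 1\<close> otherwise; for \<open>a = b\<close> the
  probability vanishes unless \<open>S = R\<close>, and the denominator is \<open>n\<close>.

  There are \<open>n (n - 1)\<close> pairs with \<open>a \<noteq> b\<close> and \<open>n\<close> pairs with \<open>a = b\<close>, and
  each kind contributes equal terms, so these counts lower the exponents of the
  denominators from \<open>T\<close> to \<open>T - 1\<close> (\<open>expectation_x_set_mult\<close>). Summing over
  \<open>S\<close> and \<open>R\<close> with the diagonal \<open>S = R\<close> split off gives the formula.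
\<close>

section \<open>One uniform subset of fixed size\<close>

lemma real_choose_two: "real (j choose 2) = real j * (real j - 1) / 2"
  by (simp add: binomial_gbinomial gbinomial_prod_rev numeral_2_eq_2)

text \<open>
  Removing \<open>B\<close> turns the subsets of \<open>N\<close> of size \<open>k\<close> that contain \<open>B\<close> into the
  subsets of \<open>N - B\<close> of size \<open>k - card B\<close>.
\<close>
lemma card_supersets:
  assumes "finite N" "B \<subseteq> N" "card B \<le> k"
  shows "card {A. B \<subseteq> A \<and> A \<subseteq> N \<and> card A = k} = (card N - card B) choose (k - card B)"
proof -
  have fB: "finite B" using assms finite_subset by blast
  have "bij_betw (\<lambda>C. C \<union> B) {C. C \<subseteq> N - B \<and> card C = k - card B}
          {A. B \<subseteq> A \<and> A \<subseteq> N \<and> card A = k}"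
  proof (rule bij_betw_byWitness[where f' = "\<lambda>A. A - B"], goal_cases)
    case 3
    show ?case
    proof safe
      fix C assume C: "C \<subseteq> N - B" "card C = k - card B"
      have "finite C" using C(1) assms(1) finite_subset by blast
      then have "card (C \<union> B) = card C + card B"
        using C fB by (intro card_Un_disjoint) auto
      then show "card (C \<union> B) = k" using C assms by simp
    qed (use assms in auto)
  next
    case 4
    show ?case using fB by (auto simp: card_Diff_subset)
  qed auto
  from bij_betw_same_card[OF this] show ?thesis
    using assms fB by (simp add: n_subsets card_Diff_subset)
qed

abbreviation ksubset_pmf :: "'a set \<Rightarrow> nat \<Rightarrow> 'a set pmf" where
  "ksubset_pmf N k \<equiv> pmf_of_set {A. A \<subseteq> N \<and> card A = k}"

locale uniform_ksubset =
  fixes N :: "'a set" and k :: nat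
  assumes finite_N: "finite N" and k_le: "k \<le> card N"
begin

lemma ksubsets_finite: "finite {A. A \<subseteq> N \<and> card A = k}"
  using finite_N by simp

lemma ksubsets_nonempty: "{A. A \<subseteq> N \<and> card A = k} \<noteq> {}"
  using obtain_subset_with_card_n[OF k_le] by blast

lemma set_ksubset_pmf: "set_pmf (ksubset_pmf N k) = {A. A \<subseteq> N \<and> card A = k}"
  using ksubsets_finite ksubsets_nonempty by simp

lemma integrable_ksubset [simp]: "integrable (measure_pmf (ksubset_pmf N k)) (f :: _ \<Rightarrow> real)"
  by (rule integrable_measure_pmf_finite) (use finite_N in \<open>simp add: set_ksubset_pmf\<close>)

text \<open>
  Count the pairs \<open>B' \<subseteq> A\<close> with \<open>card B' = card B\<close> and \<open>card A = k\<close> in two ways: the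
  number of \<open>A\<close> above \<open>B'\<close> is the same for all \<open>B'\<close>. In this form the value is also
  correct when \<open>B\<close> has more than \<open>k\<close> elements, since the numerator is then zero.
\<close>
lemma expectation_superset:
  assumes B: "B \<subseteq> N"
  shows "measure_pmf.expectation (ksubset_pmf N k) (\<lambda>A. of_bool (B \<subseteq> A))
           = real (k choose card B) / real (card N choose card B)"
proof -
  define c where "c = card {A. B \<subseteq> A \<and> A \<subseteq> N \<and> card A = k}"
  have le: "card B \<le> card N" using B finite_N by (rule card_mono[rotated])
  have count: "(card N choose card B) * c = (card N choose k) * (k choose card B)"
  proof (cases "card B \<le> k")
    case True
    then show ?thesis
      using card_supersets[OF finite_N B True] choose_mult[OF True k_le] by (simp add: c_def)
  next
    case False
    have "{A. B \<subseteq> A \<and> A \<subseteq> N \<and> card A = k} = {}"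
      using False card_mono[OF finite_subset[OF _ finite_N]] by blast
    then have "c = 0" unfolding c_def by (simp only: card.empty)
    then show ?thesis using False by simp
  qed
  have "{A. A \<subseteq> N \<and> card A = k} \<inter> {A. B \<subseteq> A} = {A. B \<subseteq> A \<and> A \<subseteq> N \<and> card A = k}"
    by auto
  then have "measure_pmf.expectation (ksubset_pmf N k) (\<lambda>A. of_bool (B \<subseteq> A))
               = real c / real (card N choose k)"
    unfolding c_def using ksubsets_finite ksubsets_nonempty finite_N
    by (simp add: integral_pmf_of_set n_subsets)
  moreover have "real (card N choose card B) * real c = real (card N choose k) * real (k choose card B)"
    using count by (simp only: of_nat_mult [symmetric])
  moreover have "real (card N choose k) \<noteq> 0" "real (card N choose card B) \<noteq> 0"
    using k_le le by auto
  ultimately show ?thesis by (simp add: frac_eq_eq mult.commute)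
qed

lemma expectation_mem:
  assumes "a \<in> N"
  shows "measure_pmf.expectation (ksubset_pmf N k) (\<lambda>A. of_bool (a \<in> A)) = real k / real (card N)"
  using expectation_superset[of "{a}"] assms by simp

lemma expectation_mem_pair:
  assumes "a \<in> N" "b \<in> N" "a \<noteq> b"
  shows "measure_pmf.expectation (ksubset_pmf N k) (\<lambda>A. of_bool (a \<in> A \<and> b \<in> A))
           = real k * (real k - 1) / (real (card N) * (real (card N) - 1))"
proof -
  have "card {a, b} = 2" using assms by simp
  with expectation_superset[of "{a, b}"] assms show ?thesis
    by (simp only: real_choose_two) simp
qed

text \<open>
  The value \<open>p\<close> tells whether \<open>a\<close> should belong to the random set. This lets the two
  alternatives for \<open>a\<close>, chosen by whether an index lies in a pattern, be handled by one
  statement.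
\<close>
lemma expectation_mem_or_not:
  assumes "a \<in> N"
  shows "measure_pmf.expectation (ksubset_pmf N k) (\<lambda>A. of_bool ((a \<in> A) = p))
           = (if p then real k else real (card N) - real k) / real (card N)"
proof -
  have N: "real (card N) > 0" using assms finite_N card_gt_0_iff by fastforce
  have "measure_pmf.expectation (ksubset_pmf N k) (\<lambda>A. of_bool (a \<notin> A) :: real)
      = measure_pmf.expectation (ksubset_pmf N k) (\<lambda>A. 1 - of_bool (a \<in> A))"
    by (intro Bochner_Integration.integral_cong) auto
  also have "\<dots> = 1 - real k / real (card N)"
    using expectation_mem[OF assms] by simp
  finally show ?thesis using expectation_mem[OF assms] N by (cases p) (auto simp: field_simps)
qed

text \<open>
  All four cases are affine combinations of the probabilities that the random set contains
  \<open>a\<close>, contains \<open>b\<close>, or contains both. Complementation exchanges \<open>k\<close> and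
  \<open>card N - k\<close>, which is why a single formula in \<open>c\<close> covers both equal values of
  \<open>p\<close> and \<open>q\<close>.
\<close>
lemma expectation_mem_or_not_pair:
  assumes ab: "a \<in> N" "b \<in> N" "a \<noteq> b"
  defines "c \<equiv> \<lambda>p. if p then real k else real (card N) - real k"
  shows "measure_pmf.expectation (ksubset_pmf N k)
             (\<lambda>A. of_bool ((a \<in> A) = p) * of_bool ((b \<in> A) = q))
           = c p * (if p = q then c p - 1 else c q) / (real (card N) * (real (card N) - 1))"
proof -
  define E :: "('a set \<Rightarrow> real) \<Rightarrow> real" where "E = measure_pmf.expectation (ksubset_pmf N k)"
  define n where "n = real (card N)"
  have "2 \<le> card N" using card_mono[OF finite_N, of "{a,b}"] ab by simp
  then have n: "n > 0" "n - 1 > 0" by (auto simp: n_def)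
  define u where "u = real k / n"
  define v where "v = real k * (real k - 1) / (n * (n - 1))"
  have u: "E (\<lambda>A. of_bool (a \<in> A)) = u" "E (\<lambda>A. of_bool (b \<in> A)) = u"
    using expectation_mem ab by (auto simp: E_def u_def n_def)
  have v: "E (\<lambda>A. of_bool (a \<in> A \<and> b \<in> A)) = v"
    using expectation_mem_pair[OF ab] by (auto simp: E_def v_def n_def)
  \<comment> \<open>Expand the product, writing the indicator of a complement as 1 minus the indicator.\<close>
  have "E (\<lambda>A. of_bool ((a \<in> A) = p) * of_bool ((b \<in> A) = q)) =
    E (\<lambda>A. of_bool (\<not> p \<and> \<not> q) + (if q then -1 else 1) * (if p then -1 else 1) * of_bool (a \<in> A \<and> b \<in> A)
       + of_bool (\<not> q) * (if p then 1 else -1) * of_bool (a \<in> A)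
       + of_bool (\<not> p) * (if q then 1 else -1) * of_bool (b \<in> A))"
    unfolding E_def by (intro Bochner_Integration.integral_cong) auto
  also have "\<dots> = of_bool (\<not> p \<and> \<not> q) + (if q then -1 else 1) * (if p then -1 else 1) * v
       + of_bool (\<not> q) * (if p then 1 else -1) * u + of_bool (\<not> p) * (if q then 1 else -1) * u"
    using u v unfolding E_def by simp
  also have "\<dots> = c p * (if p = q then c p - 1 else c q) / (n * (n - 1))"
    using n unfolding c_def u_def v_def n_def[symmetric]
    by (cases p; cases q) (auto simp: field_simps)
  finally show ?thesis unfolding E_def n_def .
qed

end


section \<open>Membership patterns\<close>

definition membership_pattern :: "nat \<Rightarrow> (nat \<Rightarrow> 'a set) \<Rightarrow> 'a \<Rightarrow> nat set" where
  "membership_pattern T M a = {i \<in> {1..T}. a \<in> M i}"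

lemma real_x_set:
  assumes "finite N" "S \<subseteq> {1..T}"
  shows "real (x_set N T S M) = (\<Sum>a\<in>N. of_bool (membership_pattern T M a = S))"
proof -
  have "{a \<in> N. (\<forall>i\<in>S. a \<in> M i) \<and> (\<forall>i\<in>{1..T} - S. a \<notin> M i)} = N \<inter> {a. membership_pattern T M a = S}"
    using assms(2) by (auto simp: membership_pattern_def)
  then show ?thesis using assms(1) by (simp add: x_set_def)
qed

lemma finite_tsubsets [simp]: "finite (tsubsets T t)"
  by (simp add: tsubsets_def)

text \<open>Every element has exactly one pattern, so counting by patterns counts it once.\<close>
lemma real_x_num:
  assumes "finite N"
  shows "real (x_num N T t M) = (\<Sum>S\<in>tsubsets T t. real (x_set N T S M))"
proof -
  have "(\<Sum>S\<in>tsubsets T t. real (x_set N T S M))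
          = (\<Sum>S\<in>tsubsets T t. \<Sum>a\<in>N. of_bool (membership_pattern T M a = S))"
    using real_x_set[OF assms] by (intro sum.cong) (auto simp: tsubsets_def)
  also have "\<dots> = (\<Sum>a\<in>N. \<Sum>S\<in>tsubsets T t. of_bool (membership_pattern T M a = S))"
    by (rule sum.swap)
  also have "\<dots> = (\<Sum>a\<in>N. of_bool (card (membership_pattern T M a) = t))"
  proof (rule sum.cong)
    fix a
    have "membership_pattern T M a \<in> tsubsets T t \<longleftrightarrow> card (membership_pattern T M a) = t"
      by (auto simp: membership_pattern_def tsubsets_def)
    then show "(\<Sum>S\<in>tsubsets T t. of_bool (membership_pattern T M a = S)) = (of_bool (card (membership_pattern T M a) = t) :: real)"
      by (simp add: of_bool_def sum.delta')
  qed simp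
  also have "\<dots> = real (x_num N T t M)"
    using assms by (simp add: x_num_def membership_pattern_def Int_def)
  finally show ?thesis by simp
qed

text \<open>
  Written as a product of functions of the separate \<open>M i\<close>, the indicator of a pattern is
  ready for the use of independence.
\<close>
lemma of_bool_pattern_eq_prod:
  assumes "S \<subseteq> {1..T}"
  shows "of_bool (membership_pattern T M a = S) = (\<Prod>i\<in>{1..T}. of_bool ((a \<in> M i) = (i \<in> S)) :: real)"
proof -
  have "membership_pattern T M a = S \<longleftrightarrow> (\<forall>i\<in>{1..T}. (a \<in> M i) = (i \<in> S))"
    using assms by (auto simp: membership_pattern_def)
  then show ?thesis by (auto intro!: prod_zero)
qed

section \<open>Independent uniform subsets\<close>

locale independent_ksubsets =
  fixes N :: "'a set" and T :: nat and m :: "nat \<Rightarrow> nat"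
  assumes finite_N: "finite N" and m_le: "\<And>i. i \<in> {1..T} \<Longrightarrow> m i \<le> card N"
begin

lemma uniform_ksubset: "i \<in> {1..T} \<Longrightarrow> uniform_ksubset N (m i)"
  using finite_N m_le by unfold_locales

lemma integrable_subsets [simp]:
  "integrable (measure_pmf (subsets_pmf N T m)) (f :: _ \<Rightarrow> real)"
proof (rule integrable_measure_pmf_finite)
  have "finite (set_pmf (ksubset_pmf N (m i)))" if "i \<in> {1..T}" for i
    using uniform_ksubset.set_ksubset_pmf[OF uniform_ksubset[OF that]] finite_N by simp
  then show "finite (set_pmf (subsets_pmf N T m))"
    unfolding subsets_pmf_def by (subst set_Pi_pmf) auto
qed

lemma expectation_prod:
  fixes f :: "nat \<Rightarrow> 'a set \<Rightarrow> real"
  assumes "\<And>i A. f i A \<ge> 0"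
  shows "measure_pmf.expectation (subsets_pmf N T m) (\<lambda>M. \<Prod>i\<in>{1..T}. f i (M i))
           = (\<Prod>i\<in>{1..T}. measure_pmf.expectation (ksubset_pmf N (m i)) (f i))"
  unfolding subsets_pmf_def
  by (rule expectation_prod_Pi_pmf)
     (use assms uniform_ksubset.integrable_ksubset[OF uniform_ksubset] in auto)

lemma expectation_pattern:
  assumes "S \<subseteq> {1..T}" "a \<in> N"
  shows "measure_pmf.expectation (subsets_pmf N T m) (\<lambda>M. of_bool (membership_pattern T M a = S))
           = (\<Prod>i\<in>{1..T}. m_sup (card N) m S i) / real (card N) ^ T"
proof -
  have "measure_pmf.expectation (subsets_pmf N T m) (\<lambda>M. of_bool (membership_pattern T M a = S))
      = (\<Prod>i\<in>{1..T}. measure_pmf.expectation (ksubset_pmf N (m i))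
            (\<lambda>A. of_bool ((a \<in> A) = (i \<in> S)) :: real))"
    unfolding of_bool_pattern_eq_prod[OF assms(1)]
    by (rule expectation_prod[where f = "\<lambda>i A. of_bool ((a \<in> A) = (i \<in> S))"]) simp
  also have "\<dots> = (\<Prod>i\<in>{1..T}. m_sup (card N) m S i / real (card N))"
    using uniform_ksubset.expectation_mem_or_not[OF uniform_ksubset assms(2)]
    by (intro prod.cong) (auto simp: m_sup_def)
  finally show ?thesis by (simp add: prod_dividef)
qed

text \<open>
  An index at which \<open>S\<close> and \<open>R\<close> differ asks the random set to contain one of \<open>a\<close>,
  \<open>b\<close> and to avoid the other; an index at which they agree treats \<open>a\<close> and \<open>b\<close> alike.
  This is the origin of the two products.
\<close>
lemma expectation_pattern_pair:
  assumes S: "S \<subseteq> {1..T}" and R: "R \<subseteq> {1..T}" and ab: "a \<in> N" "b \<in> N" "a \<noteq> b"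
  shows "measure_pmf.expectation (subsets_pmf N T m)
             (\<lambda>M. of_bool (membership_pattern T M a = S) * of_bool (membership_pattern T M b = R))
           = (\<Prod>i\<in>sym_diff S R. real (m i) * (real (card N) - real (m i)))
             * (\<Prod>i\<in>{1..T} - sym_diff S R. m_sup (card N) m S i * (m_sup (card N) m S i - 1))
             / (real (card N) * (real (card N) - 1)) ^ T"
proof -
  let ?n = "real (card N)"
  let ?f = "\<lambda>i. if i \<in> sym_diff S R then real (m i) * (?n - real (m i))
                 else m_sup (card N) m S i * (m_sup (card N) m S i - 1)"
  have D: "sym_diff S R \<subseteq> {1..T}" using S R by auto
  have "measure_pmf.expectation (subsets_pmf N T m)
             (\<lambda>M. of_bool (membership_pattern T M a = S) * of_bool (membership_pattern T M b = R))
      = (\<Prod>i\<in>{1..T}. measure_pmf.expectation (ksubset_pmf N (m i))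
            (\<lambda>A. of_bool ((a \<in> A) = (i \<in> S)) * of_bool ((b \<in> A) = (i \<in> R)) :: real))"
    unfolding of_bool_pattern_eq_prod[OF S] of_bool_pattern_eq_prod[OF R] prod.distrib[symmetric]
    by (rule expectation_prod[where
          f = "\<lambda>i A. of_bool ((a \<in> A) = (i \<in> S)) * of_bool ((b \<in> A) = (i \<in> R))"]) simp
  also have "\<dots> = (\<Prod>i\<in>{1..T}. ?f i / (?n * (?n - 1)))"
    using uniform_ksubset.expectation_mem_or_not_pair[OF uniform_ksubset ab]
    by (intro prod.cong) (auto simp: m_sup_def)
  also have "\<dots> = (\<Prod>i\<in>{1..T}. ?f i) / (?n * (?n - 1)) ^ T"
    by (simp add: prod_dividef)
  also have "(\<Prod>i\<in>{1..T}. ?f i) = (\<Prod>i\<in>{1..T} - sym_diff S R. ?f i) * (\<Prod>i\<in>sym_diff S R. ?f i)"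
    using D by (intro prod.subset_diff) auto
  also have "(\<Prod>i\<in>{1..T} - sym_diff S R. ?f i)
      = (\<Prod>i\<in>{1..T} - sym_diff S R. m_sup (card N) m S i * (m_sup (card N) m S i - 1))"
    by (intro prod.cong) auto
  also have "(\<Prod>i\<in>sym_diff S R. ?f i) = (\<Prod>i\<in>sym_diff S R. real (m i) * (?n - real (m i)))"
    by (intro prod.cong) auto
  finally show ?thesis by (simp only: mult.commute)
qed

text \<open>
  The first summand comes from the pairs of distinct elements, the second from the pairs
  \<open>(a, a)\<close>, where the single pattern of \<open>a\<close> must equal both \<open>S\<close> and \<open>R\<close>.
\<close>
lemma expectation_x_set_mult:
  assumes S: "S \<subseteq> {1..T}" and R: "R \<subseteq> {1..T}"
    and T: "T \<ge> 1" and n: "card N \<ge> 2"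
  defines "n \<equiv> real (card N)"
  shows "measure_pmf.expectation (subsets_pmf N T m)
             (\<lambda>M. real (x_set N T S M) * real (x_set N T R M))
           = (\<Prod>i\<in>sym_diff S R. real (m i) * (n - real (m i)))
             * (\<Prod>i\<in>{1..T} - sym_diff S R. m_sup (card N) m S i * (m_sup (card N) m S i - 1))
             / (n ^ (T - 1) * (n - 1) ^ (T - 1))
             + of_bool (S = R) * ((\<Prod>i\<in>{1..T}. m_sup (card N) m S i) / n ^ (T - 1))"
proof -
  define E :: "((nat \<Rightarrow> 'a set) \<Rightarrow> real) \<Rightarrow> real"
    where "E = measure_pmf.expectation (subsets_pmf N T m)"
  define P where "P = (\<Prod>i\<in>sym_diff S R. real (m i) * (n - real (m i)))
             * (\<Prod>i\<in>{1..T} - sym_diff S R. m_sup (card N) m S i * (m_sup (card N) m S i - 1))"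
  define Q where "Q = (\<Prod>i\<in>{1..T}. m_sup (card N) m S i)"
  define e where "e a b = E (\<lambda>M. of_bool (membership_pattern T M a = S) * of_bool (membership_pattern T M b = R))" for a b
  obtain t where t: "T = Suc t" using T by (cases T) auto
  have n0: "n > 0" "n - 1 > 0" using n by (auto simp: n_def)
  have diag: "e a a = of_bool (S = R) * (Q / n ^ T)" if "a \<in> N" for a
  proof -
    have "e a a = E (\<lambda>M. of_bool (S = R) * of_bool (membership_pattern T M a = S))"
      unfolding e_def by (intro arg_cong[where f = E]) auto
    then show ?thesis
      using expectation_pattern[OF S that] by (simp add: E_def Q_def n_def)
  qed
  have off: "e a b = P / (n * (n - 1)) ^ T" if "a \<in> N" "b \<in> N - {a}" for a b
    using expectation_pattern_pair[OF S R, of a b] that unfolding e_def E_def P_def n_def by auto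
  have "E (\<lambda>M. real (x_set N T S M) * real (x_set N T R M)) = (\<Sum>a\<in>N. \<Sum>b\<in>N. e a b)"
    unfolding e_def E_def
    by (simp add: real_x_set[OF finite_N S] real_x_set[OF finite_N R] sum_product
             del: sum_of_bool_eq sum_mult_of_bool_eq sum_of_bool_mult_eq)
  also have "\<dots> = (\<Sum>a\<in>N. e a a + (\<Sum>b\<in>N - {a}. e a b))"
    using finite_N by (intro sum.cong refl sum.remove) auto
  also have "\<dots> = (\<Sum>a\<in>N. of_bool (S = R) * (Q / n ^ T) + (n - 1) * (P / (n * (n - 1)) ^ T))"
  proof (rule sum.cong)
    fix a assume a: "a \<in> N"
    have "real (card (N - {a})) = n - 1"
      using a n by (simp add: n_def of_nat_diff)
    then show "e a a + (\<Sum>b\<in>N - {a}. e a b)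
        = of_bool (S = R) * (Q / n ^ T) + (n - 1) * (P / (n * (n - 1)) ^ T)"
      using diag[OF a] off[OF a] by simp
  qed simp
  also have "\<dots> = of_bool (S = R) * (n * (Q / n ^ T)) + n * (n - 1) * P / (n * (n - 1)) ^ T"
    by (simp add: n_def algebra_simps)
  also have "n * (Q / n ^ T) = Q / n ^ (T - 1)"
    using n0 by (simp add: t)
  also have "n * (n - 1) * P / (n * (n - 1)) ^ T = P / (n * (n - 1)) ^ (T - 1)"
    using n0 by (simp add: t)
  finally show ?thesis by (simp add: E_def P_def Q_def power_mult_distrib)
qed

end

section \<open>The second moment\<close>

theorem theorem4:
  fixes N :: "'a set" and n T t :: nat and m :: "nat \<Rightarrow> nat"
  assumes "finite N" and "card N = n"
    and "T \<ge> 2" and "n \<ge> 2"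
    and "\<And>i. i \<in> {1..T} \<Longrightarrow> m i \<le> n"
    and "t \<le> T"
  shows
    "measure_pmf.expectation (subsets_pmf N T m) (\<lambda>M. (real (x_num N T t M))\<^sup>2)
       = (\<Sum>(S, R) \<in> tsubsets T t \<times> tsubsets T t.
            measure_pmf.expectation (subsets_pmf N T m)
              (\<lambda>M. real (x_set N T S M) * real (x_set N T R M)))
     \<and>
     (\<Sum>(S, R) \<in> tsubsets T t \<times> tsubsets T t.
        measure_pmf.expectation (subsets_pmf N T m)
          (\<lambda>M. real (x_set N T S M) * real (x_set N T R M)))
       = (\<Sum>(S, R) \<in> {(S, R). S \<in> tsubsets T t \<and> R \<in> tsubsets T t \<and> S \<noteq> R}.
            ((\<Prod>i \<in> sym_diff S R. real (m i) * (real n - real (m i))) *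
             (\<Prod>i \<in> {1..T} - sym_diff S R. m_sup n m S i * (m_sup n m S i - 1)))
            / (real n ^ (T - 1) * (real n - 1) ^ (T - 1)))
         + (\<Sum>S \<in> tsubsets T t.
            (\<Prod>i = 1..T. m_sup n m S i) / real n ^ (T - 1)
            * (1 + (\<Prod>i = 1..T. m_sup n m S i - 1) / (real n - 1) ^ (T - 1)))"
proof -
  let ?E = "\<lambda>S R. measure_pmf.expectation (subsets_pmf N T m)
               (\<lambda>M. real (x_set N T S M) * real (x_set N T R M))"
  interpret independent_ksubsets N T m
    using assms by unfold_locales auto
  have sub: "S \<subseteq> {1..T}" if "S \<in> tsubsets T t" for S
    using that by (simp add: tsubsets_def)
  have E: "?E S R = (\<Prod>i\<in>sym_diff S R. real (m i) * (real n - real (m i)))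
             * (\<Prod>i\<in>{1..T} - sym_diff S R. m_sup n m S i * (m_sup n m S i - 1))
             / (real n ^ (T - 1) * (real n - 1) ^ (T - 1))
             + of_bool (S = R) * ((\<Prod>i\<in>{1..T}. m_sup n m S i) / real n ^ (T - 1))"
    if "S \<in> tsubsets T t" "R \<in> tsubsets T t" for S R
    using expectation_x_set_mult[OF sub[OF that(1)] sub[OF that(2)]] assms by simp
  have first: "measure_pmf.expectation (subsets_pmf N T m) (\<lambda>M. (real (x_num N T t M))\<^sup>2)
      = (\<Sum>(S, R) \<in> tsubsets T t \<times> tsubsets T t. ?E S R)"
    by (simp add: real_x_num[OF assms(1)] power2_eq_square sum_product flip: sum.cartesian_product)
  let ?D = "{(S, R). S \<in> tsubsets T t \<and> R \<in> tsubsets T t \<and> S \<noteq> R}"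
  let ?I = "(\<lambda>S. (S, S)) ` tsubsets T t"
  have split: "tsubsets T t \<times> tsubsets T t = ?D \<union> ?I" and disj: "?D \<inter> ?I = {}"
    by auto
  have fin: "finite ?D"
    by (rule finite_subset[of _ "tsubsets T t \<times> tsubsets T t"]) auto
  have "(\<Sum>(S, R) \<in> tsubsets T t \<times> tsubsets T t. ?E S R)
      = (\<Sum>(S, R) \<in> ?D. ?E S R) + (\<Sum>(S, R) \<in> ?I. ?E S R)"
    unfolding split by (rule sum.union_disjoint[OF fin _ disj]) simp
  also have "(\<Sum>(S, R) \<in> ?I. ?E S R) = (\<Sum>S \<in> tsubsets T t. ?E S S)"
    by (subst sum.reindex) (auto simp: inj_on_def)
  also have "\<dots> = (\<Sum>S \<in> tsubsets T t.
            (\<Prod>i = 1..T. m_sup n m S i) / real n ^ (T - 1)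
            * (1 + (\<Prod>i = 1..T. m_sup n m S i - 1) / (real n - 1) ^ (T - 1)))"
    by (intro sum.cong refl) (simp add: E prod.distrib distrib_left add.commute)
  also have "(\<Sum>(S, R) \<in> ?D. ?E S R) = (\<Sum>(S, R) \<in> ?D.
            ((\<Prod>i \<in> sym_diff S R. real (m i) * (real n - real (m i))) *
             (\<Prod>i \<in> {1..T} - sym_diff S R. m_sup n m S i * (m_sup n m S i - 1)))
            / (real n ^ (T - 1) * (real n - 1) ^ (T - 1)))"
    by (intro sum.cong refl) (auto simp: E)
  finally show ?thesis using first by (intro conjI)
qed

end
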